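(* Let $X$ and $Y$ be Tychonoff spaces and let $\varphi:D_p(X)\to D_p(Y)$ be a continuous linear map such that $\varphi(D_p(X))$ is dense in $D_p(Y)$. Then $K(y)=\operatorname{supp}(y)$ for every $y\in Y$, and $\varphi$ is bounded (in the sense of finite sets $K$ with $a_\varphi(y,K)\le m$ for a common $m$) if and only if $\varphi$ is norm-bounded.
   Context: For a Tychonoff space $X$, $C_p(X)$ is the space of all continuous real-valued functions on $X$ with the topology of pointwise convergence, and $C_p^*(X)$ is its subspace consisting of the bounded functions. $D_p(X)$ denotes either $C_p(X)$ or $C_p^*(X)$, and likewise $D_p(Y)$ (the choices for $X$ and $Y$ are independent). For $y\in Y$ and $K\subset X$ put $$a_\varphi(y,K)=\sup\{|\varphi(f)(y)-\varphi(g)(y)|: f,g\in D_p(X)\text{ and } |f(x)-g(x)|<1\ \ \forall x\in K\}\in[0,\infty].$$ Let $\mathcal A(y)=\{K\subset X: K\text{ finite and } a_\varphi(y,K)<\infty\}$ and $K(y)=\bigcap\mathcal A(y)$. The map $\varphi$ is called bounded if there is $m\in\mathbb N$ such that for every $y\in Y$ there is a finite set $K\subset X$ with $a_\varphi(y,K)\leq m$. For $y\in Y$, $\operatorname{supp}(y)$ is the set of all $x\in X$ such that for every neighborhood $U_x$ of $x$ in $X$ there is $f\in D_p(X)$ with $f(X\setminus U_x)\subset\{0\}$ and $\varphi(f)(y)\neq 0$. The map $\varphi$ is norm-bounded if $\|\varphi\|=\sup\{|\varphi(f)(y)|: f\in D_p(X),\ \|f\|<1,\ y\in Y\}<\infty$,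 where $\|f\|=\sup_{x\in X}|f(x)|$. *)

theory Defs
  imports "HOL-Analysis.Analysis"
begin

definition Tychonoff_space :: "'a topology \<Rightarrow> bool" where
  "Tychonoff_space X \<longleftrightarrow> completely_regular_space X \<and> t1_space X"

(* A real-valued function on X is represented by the element of the power
   topology that is undefined outside the underlying set of X (extensional), so
   that distinct elements of C_p X are distinct functions on topspace X. *)

definition C_p :: "'a topology \<Rightarrow> ('a \<Rightarrow> real) topology" where
  "C_p X = subtopology (powertop_real (topspace X)) {f. continuous_map X euclideanreal f}"

definition C_p_star :: "'a topology \<Rightarrow> ('a \<Rightarrow> real) topology" where
  "C_p_star X = subtopology (C_p X) {f. bounded (f ` topspace X)}"

(* Below, DX is the space D_p(X), that is, C_p X or C_p_star X.  The vector
   operations are pointwise; restrict keeps the results extensional. *)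

definition linear_fun_map ::
  "'a topology \<Rightarrow> 'b topology \<Rightarrow> ('a \<Rightarrow> real) topology \<Rightarrow> (('a \<Rightarrow> real) \<Rightarrow> ('b \<Rightarrow> real)) \<Rightarrow> bool" where
  "linear_fun_map X Y DX \<phi> \<longleftrightarrow>
     (\<forall>f \<in> topspace DX. \<forall>g \<in> topspace DX.
        \<phi> (\<lambda>x\<in>topspace X. f x + g x) = (\<lambda>y\<in>topspace Y. \<phi> f y + \<phi> g y)) \<and>
     (\<forall>c. \<forall>f \<in> topspace DX.
        \<phi> (\<lambda>x\<in>topspace X. c * f x) = (\<lambda>y\<in>topspace Y. c * \<phi> f y))"

definition a_val ::
  "('a \<Rightarrow> real) topology \<Rightarrow> (('a \<Rightarrow> real) \<Rightarrow> ('b \<Rightarrow> real)) \<Rightarrow> 'b \<Rightarrow> 'a set \<Rightarrow> ennreal" where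
  "a_val DX \<phi> y K =
     (SUP (f, g) \<in> {(f, g). f \<in> topspace DX \<and> g \<in> topspace DX \<and> (\<forall>x\<in>K. \<bar>f x - g x\<bar> < 1)}.
        ennreal \<bar>\<phi> f y - \<phi> g y\<bar>)"

definition A_family ::
  "'a topology \<Rightarrow> ('a \<Rightarrow> real) topology \<Rightarrow> (('a \<Rightarrow> real) \<Rightarrow> ('b \<Rightarrow> real)) \<Rightarrow> 'b \<Rightarrow> 'a set set" where
  "A_family X DX \<phi> y = {K. K \<subseteq> topspace X \<and> finite K \<and> a_val DX \<phi> y K < \<infinity>}"

(* The intersection is taken among subsets of topspace X; this matters only for
   an empty family. *)
definition K_set ::
  "'a topology \<Rightarrow> ('a \<Rightarrow> real) topology \<Rightarrow> (('a \<Rightarrow> real) \<Rightarrow> ('b \<Rightarrow> real)) \<Rightarrow> 'b \<Rightarrow> 'a set" where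
  "K_set X DX \<phi> y = topspace X \<inter> \<Inter> (A_family X DX \<phi> y)"

definition supp ::
  "'a topology \<Rightarrow> ('a \<Rightarrow> real) topology \<Rightarrow> (('a \<Rightarrow> real) \<Rightarrow> ('b \<Rightarrow> real)) \<Rightarrow> 'b \<Rightarrow> 'a set" where
  "supp X DX \<phi> y =
     {x \<in> topspace X. \<forall>U. U \<subseteq> topspace X \<and> x \<in> X interior_of U \<longrightarrow>
        (\<exists>f \<in> topspace DX. f ` (topspace X - U) \<subseteq> {0} \<and> \<phi> f y \<noteq> 0)}"

definition bounded_map ::
  "'a topology \<Rightarrow> 'b topology \<Rightarrow> ('a \<Rightarrow> real) topology \<Rightarrow> (('a \<Rightarrow> real) \<Rightarrow> ('b \<Rightarrow> real)) \<Rightarrow> bool" where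
  "bounded_map X Y DX \<phi> \<longleftrightarrow>
     (\<exists>m::nat. \<forall>y \<in> topspace Y. \<exists>K. K \<subseteq> topspace X \<and> finite K \<and> a_val DX \<phi> y K \<le> of_nat m)"

(* The values lie in [0,\<infinity>]: the norm of an unbounded f is infinite, and both
   suprema are 0 when taken over the empty set. *)

definition sup_norm :: "'a topology \<Rightarrow> ('a \<Rightarrow> real) \<Rightarrow> ennreal" where
  "sup_norm X f = (SUP x \<in> topspace X. ennreal \<bar>f x\<bar>)"

definition map_norm ::
  "'a topology \<Rightarrow> 'b topology \<Rightarrow> ('a \<Rightarrow> real) topology \<Rightarrow> (('a \<Rightarrow> real) \<Rightarrow> ('b \<Rightarrow> real)) \<Rightarrow> ennreal" where
  "map_norm X Y DX \<phi> =
     (SUP (f, y) \<in> {f \<in> topspace DX. sup_norm X f < 1} \<times> topspace Y. ennreal \<bar>\<phi> f y\<bar>)"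

definition norm_bounded_map ::
  "'a topology \<Rightarrow> 'b topology \<Rightarrow> ('a \<Rightarrow> real) topology \<Rightarrow> (('a \<Rightarrow> real) \<Rightarrow> ('b \<Rightarrow> real)) \<Rightarrow> bool" where
  "norm_bounded_map X Y DX \<phi> \<longleftrightarrow> map_norm X Y DX \<phi> < \<infinity>"

end

theory Submission
  imports Defs
begin

text \<open>
  For fixed \<open>y\<close>, the map \<open>f \<mapsto> \<phi> f y\<close> is a linear functional on \<open>D_p(X)\<close>, and by continuity at
  \<open>0\<close> it vanishes on all functions that vanish on some finite set. Hence it is a finite combination
  \<open>\<Sum>s\<in>S. c s * f s\<close> of point evaluations with nonzero coefficients, and bump functions show that
  both \<open>K(y)\<close> and \<open>supp(y)\<close> equal \<open>S\<close>. Since the functional only sees \<open>f\<close> on \<open>S\<close>, a function that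
  is smaller than \<open>1\<close> on \<open>S\<close> may be truncated to one of norm smaller than \<open>1\<close> without changing the
  value at \<open>y\<close>, so that \<open>a_\<phi>(y, S) \<le> \<parallel>\<phi>\<parallel>\<close>.
\<close>

section \<open>Points and zero neighbourhoods of the function spaces\<close>

lemma topspace_C_p:
  "topspace (C_p X) = {f \<in> extensional (topspace X). continuous_map X euclideanreal f}"
  by (auto simp: C_p_def PiE_def)

lemma topspace_C_p_star:
  "topspace (C_p_star X) = {f \<in> topspace (C_p X). bounded (f ` topspace X)}"
  by (auto simp: C_p_star_def)

text \<open>A basic open box constrains only finitely many coordinates. \<open>K\<close> collects
  these, and a function vanishing on \<open>K\<close> agrees there with the zero function, so it
  stays in the box.\<close>

lemma powertop_real_zero_neighbourhood:
  assumes "openin (powertop_real I) W" and "(\<lambda>i\<in>I. 0) \<in> W"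
  obtains K where "finite K" "K \<subseteq> I"
    "\<And>f. f \<in> extensional I \<Longrightarrow> (\<And>i. i \<in> K \<Longrightarrow> f i = 0) \<Longrightarrow> f \<in> W"
proof -
  obtain U where fin: "finite {i \<in> I. U i \<noteq> topspace euclideanreal}"
    and zero: "(\<lambda>i\<in>I. 0) \<in> Pi\<^sub>E I U" and sub: "Pi\<^sub>E I U \<subseteq> W"
    using assms unfolding openin_product_topology_alt by blast
  show ?thesis
  proof (rule that[OF fin])
    fix f :: "'a \<Rightarrow> real"
    assume f: "f \<in> extensional I"
      and van: "\<And>i. i \<in> {i \<in> I. U i \<noteq> topspace euclideanreal} \<Longrightarrow> f i = 0"
    have "f i \<in> U i" if "i \<in> I" for i
    proof (cases "U i = UNIV")
      case False
      then show ?thesis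
        using zero van[of i] that by (force simp: PiE_iff)
    qed simp
    with f have "f \<in> Pi\<^sub>E I U"
      by (simp add: PiE_iff)
    with sub show "f \<in> W" ..
  qed auto
qed

section \<open>Vector operations, bumps and truncations in \<open>DX\<close>\<close>

locale D_space =
  fixes X :: "'a topology" and DX :: "('a \<Rightarrow> real) topology"
  assumes Tychonoff: "Tychonoff_space X"
    and DX: "DX = C_p X \<or> DX = C_p_star X"
begin

lemma extensionalD: "f \<in> topspace DX \<Longrightarrow> f \<in> extensional (topspace X)"
  using DX by (auto simp: topspace_C_p topspace_C_p_star)

lemma continuousD: "f \<in> topspace DX \<Longrightarrow> continuous_map X euclideanreal f"
  using DX by (auto simp: topspace_C_p topspace_C_p_star)

text \<open>Bounded continuous functions lie in both candidates for \<open>DX\<close>, so bumps and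
  truncations can be built without a case distinction.\<close>

lemma bounded_mem:
  assumes "continuous_map X euclideanreal f" and "\<And>x. x \<in> topspace X \<Longrightarrow> \<bar>f x\<bar> \<le> B"
  shows "(\<lambda>x\<in>topspace X. f x) \<in> topspace DX"
proof -
  have "continuous_map X euclideanreal (\<lambda>x\<in>topspace X. f x)"
    using assms(1) by (rule continuous_map_eq) auto
  moreover have "bounded ((\<lambda>x\<in>topspace X. f x) ` topspace X)"
    using assms(2) by (auto simp: bounded_iff)
  ultimately show ?thesis
    using DX by (auto simp: topspace_C_p topspace_C_p_star)
qed

lemma zero_mem: "(\<lambda>x\<in>topspace X. 0) \<in> topspace DX"
  by (rule bounded_mem[where B = 0]) auto

lemma scale_mem:
  assumes "f \<in> topspace DX"
  shows "(\<lambda>x\<in>topspace X. c * f x) \<in> topspace DX"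
proof -
  have "continuous_map X euclideanreal (\<lambda>x\<in>topspace X. c * f x)"
    by (rule continuous_map_eq[of _ _ "\<lambda>x. c * f x"])
      (auto intro!: continuous_map_real_mult_left continuousD[OF assms])
  moreover have "bounded ((\<lambda>x\<in>topspace X. c * f x) ` topspace X)"
    if "bounded (f ` topspace X)"
    using bounded_scaling[OF that, of c] by (simp add: image_image)
  ultimately show ?thesis
    using DX assms by (auto simp: topspace_C_p topspace_C_p_star)
qed

lemma add_mem:
  assumes "f \<in> topspace DX" and "g \<in> topspace DX"
  shows "(\<lambda>x\<in>topspace X. f x + g x) \<in> topspace DX"
proof -
  have "continuous_map X euclideanreal (\<lambda>x\<in>topspace X. f x + g x)"
    by (rule continuous_map_eq[of _ _ "\<lambda>x. f x + g x"])
      (auto intro!: continuous_map_add continuousD[OF assms(1)] continuousD[OF assms(2)])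
  moreover have "bounded ((\<lambda>x\<in>topspace X. f x + g x) ` topspace X)"
    if "bounded (f ` topspace X)" "bounded (g ` topspace X)"
    using bounded_plus_comp[OF that] by simp
  ultimately show ?thesis
    using DX assms by (auto simp: topspace_C_p topspace_C_p_star)
qed

lemma bump:
  assumes "closedin X C" and "x \<in> topspace X" and "x \<notin> C"
  obtains e where "e \<in> topspace DX" "e x = 1" "\<forall>z\<in>C. e z = 0"
proof -
  obtain f where cont: "continuous_map X (top_of_set {0..1::real}) f"
    and f: "f x = 0" "f ` C \<subseteq> {1}"
    using Tychonoff assms unfolding Tychonoff_space_def completely_regular_space_def by blast
  \<comment> \<open>Complete regularity yields the value 0 at \<open>x\<close> and 1 on
    \<open>C\<close>; the complement exchanges them.\<close>
  define e where "e = (\<lambda>z\<in>topspace X. 1 - f z)"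
  have "continuous_map X euclideanreal f" and "\<And>z. z \<in> topspace X \<Longrightarrow> f z \<in> {0..1}"
    using cont by (auto simp: continuous_map_in_subtopology)
  then have "e \<in> topspace DX"
    unfolding e_def by (intro bounded_mem[where B = 1] continuous_map_diff) auto
  moreover have "e z = 0" if "z \<in> C" for z
    using f that closedin_subset[OF assms(1)] by (auto simp: e_def)
  ultimately show ?thesis
    using f assms(2) that[of e] by (simp add: e_def)
qed

lemma finite_closedin: "finite K \<Longrightarrow> K \<subseteq> topspace X \<Longrightarrow> closedin X K"
  using Tychonoff by (simp add: Tychonoff_space_def t1_space_closedin_finite)

text \<open>Clamp \<open>f\<close> to [-b, b], where \<open>b\<close> is the maximum of |f| on
  \<open>K\<close>. Since \<open>K\<close> is finite, the maximum is attained and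
  \<open>b < 1\<close> strictly, so the sup norm also stays strictly below 1.\<close>

lemma truncation:
  assumes "f \<in> topspace DX" and "finite K" and "K \<subseteq> topspace X"
    and "\<And>x. x \<in> K \<Longrightarrow> \<bar>f x\<bar> < 1"
  obtains g where "g \<in> topspace DX" "\<And>x. x \<in> K \<Longrightarrow> g x = f x" "sup_norm X g < 1"
proof -
  \<comment> \<open>Inserting 0 covers empty \<open>K\<close> and ensures
    \<open>b \<ge> 0\<close>.\<close>
  define b where "b = Max (insert 0 ((\<lambda>x. \<bar>f x\<bar>) ` K))"
  have b: "0 \<le> b" "b < 1" "\<And>x. x \<in> K \<Longrightarrow> \<bar>f x\<bar> \<le> b"
    using assms(2,4) by (auto simp: b_def)
  define h where "h = (\<lambda>x. max (- b) (min b (f x)))"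
  have bound: "\<bar>h x\<bar> \<le> b" for x
    using b(1) by (auto simp: h_def)
  have "continuous_map X euclideanreal h"
    unfolding h_def
    by (intro continuous_map_real_max continuous_map_real_min continuousD[OF assms(1)]) auto
  then have mem: "(\<lambda>x\<in>topspace X. h x) \<in> topspace DX"
    using bound by (rule bounded_mem)
  have "(\<lambda>x\<in>topspace X. h x) x = f x" if "x \<in> K" for x
    using b(3)[OF that] assms(3) that by (auto simp: h_def abs_le_iff)
  moreover have "sup_norm X (\<lambda>x\<in>topspace X. h x) \<le> ennreal b"
    unfolding sup_norm_def using bound by (intro SUP_least) (auto intro: ennreal_leI)
  then have "sup_norm X (\<lambda>x\<in>topspace X. h x) < 1"
    using b(2) by (simp add: ennreal_less_one_iff order_le_less_trans)
  ultimately show ?thesis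
    using that mem by blast
qed

end

section \<open>Evaluations of a linear map as finite combinations\<close>

locale D_linear_map = D_space X DX for X :: "'a topology" and DX +
  fixes Y :: "'b topology" and \<phi> :: "('a \<Rightarrow> real) \<Rightarrow> 'b \<Rightarrow> real"
  assumes linear: "linear_fun_map X Y DX \<phi>"
    and continuous: "y \<in> topspace Y \<Longrightarrow> continuous_map DX euclideanreal (\<lambda>f. \<phi> f y)"
begin

lemma map_add:
  assumes "f \<in> topspace DX" "g \<in> topspace DX" "y \<in> topspace Y"
  shows "\<phi> (\<lambda>x\<in>topspace X. f x + g x) y = \<phi> f y + \<phi> g y"
  using linear assms by (simp add: linear_fun_map_def)

lemma map_scale:
  assumes "f \<in> topspace DX" "y \<in> topspace Y"
  shows "\<phi> (\<lambda>x\<in>topspace X. c * f x) y = c * \<phi> f y"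
  using linear assms by (simp add: linear_fun_map_def)

lemma map_zero: "y \<in> topspace Y \<Longrightarrow> \<phi> (\<lambda>x\<in>topspace X. 0) y = 0"
  using map_scale[OF zero_mem, of y 0] by simp

lemma diff_mem_map_diff:
  assumes "f \<in> topspace DX" "g \<in> topspace DX"
  shows "(\<lambda>x\<in>topspace X. f x - g x) \<in> topspace DX"
    and "y \<in> topspace Y \<Longrightarrow> \<phi> (\<lambda>x\<in>topspace X. f x - g x) y = \<phi> f y - \<phi> g y"
proof -
  have eq: "(\<lambda>x\<in>topspace X. f x - g x)
      = (\<lambda>x\<in>topspace X. f x + (\<lambda>x\<in>topspace X. (- 1) * g x) x)"
    by (auto simp: fun_eq_iff)
  show "(\<lambda>x\<in>topspace X. f x - g x) \<in> topspace DX"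
    unfolding eq by (intro add_mem scale_mem assms)
  show "\<phi> (\<lambda>x\<in>topspace X. f x - g x) y = \<phi> f y - \<phi> g y" if "y \<in> topspace Y"
    unfolding eq map_add[OF assms(1) scale_mem[OF assms(2)] that] map_scale[OF assms(2) that]
    by simp
qed

text \<open>Membership and value are proved together because additivity in the induction step
  requires the partial sum to lie in \<open>DX\<close>.\<close>

lemma sum_mem_map_sum:
  assumes "finite F" and "\<And>k. k \<in> F \<Longrightarrow> e k \<in> topspace DX" and "y \<in> topspace Y"
  shows "(\<lambda>x\<in>topspace X. \<Sum>k\<in>F. a k * e k x) \<in> topspace DX \<and>
    \<phi> (\<lambda>x\<in>topspace X. \<Sum>k\<in>F. a k * e k x) y = (\<Sum>k\<in>F. a k * \<phi> (e k) y)"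
  using assms(1,2)
proof (induction F)
  case empty
  then show ?case
    using zero_mem map_zero[OF assms(3)] by (simp add: restrict_def)
next
  case (insert k F)
  let ?s = "\<lambda>x\<in>topspace X. \<Sum>k\<in>F. a k * e k x" and ?t = "\<lambda>x\<in>topspace X. a k * e k x"
  have IH: "?s \<in> topspace DX" "\<phi> ?s y = (\<Sum>k\<in>F. a k * \<phi> (e k) y)"
    using insert.IH insert.prems by blast+
  have t: "?t \<in> topspace DX" "\<phi> ?t y = a k * \<phi> (e k) y"
    using insert.prems assms(3) by (auto intro: scale_mem map_scale)
  have eq: "(\<lambda>x\<in>topspace X. \<Sum>k\<in>insert k F. a k * e k x) = (\<lambda>x\<in>topspace X. ?t x + ?s x)"
    using insert by (auto simp: fun_eq_iff)
  show ?case
    unfolding eq map_add[OF t(1) IH(1) assms(3)] IH(2) t(2)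
    unfolding sum.insert[OF insert.hyps] using add_mem[OF t(1) IH(1)] by (rule conjI[OF _ refl])
qed

text \<open>By continuity at 0, the functional has absolute value below 1 on all functions vanishing
  on some finite \<open>K\<close>. These form a linear subspace, and a linear functional bounded on
  a subspace is zero there.\<close>

lemma finite_determining_set:
  assumes y: "y \<in> topspace Y"
  obtains K where "finite K" "K \<subseteq> topspace X"
    "\<And>f. f \<in> topspace DX \<Longrightarrow> (\<And>x. x \<in> K \<Longrightarrow> f x = 0) \<Longrightarrow> \<phi> f y = 0"
proof -
  have "openin DX {f \<in> topspace DX. \<phi> f y \<in> ball 0 1}"
    using continuous[OF y] by (rule openin_continuous_map_preimage) auto
  moreover obtain A where A: "DX = subtopology (powertop_real (topspace X)) A"
    using DX unfolding C_p_star_def C_p_def subtopology_subtopology by blast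
  ultimately obtain W where W: "openin (powertop_real (topspace X)) W"
    and "{f \<in> topspace DX. \<phi> f y \<in> ball 0 1} = W \<inter> A"
    by (auto simp: openin_subtopology)
  \<comment> \<open>\<open>A\<close> may contain non-extensional functions, but \<open>W\<close>,
    being open in the power topology, does not.\<close>
  moreover have "W \<inter> A = W \<inter> topspace DX"
    using openin_subset[OF W] by (auto simp: A)
  ultimately have pre: "{f \<in> topspace DX. \<phi> f y \<in> ball 0 1} = W \<inter> topspace DX"
    by simp
  have "(\<lambda>x\<in>topspace X. 0) \<in> {f \<in> topspace DX. \<phi> f y \<in> ball 0 1}"
    by (simp only: mem_Collect_eq zero_mem map_zero[OF y]) simp
  then have "(\<lambda>x\<in>topspace X. 0) \<in> W"
    unfolding pre by (rule IntD1)
  with W obtain K where K: "finite K" "K \<subseteq> topspace X"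
    and KW: "\<And>f. f \<in> extensional (topspace X) \<Longrightarrow> (\<And>x. x \<in> K \<Longrightarrow> f x = 0) \<Longrightarrow> f \<in> W"
    by (rule powertop_real_zero_neighbourhood) (rule that; blast)
  show ?thesis
  proof (rule that[OF K])
    fix f assume f: "f \<in> topspace DX" and van: "\<And>x. x \<in> K \<Longrightarrow> f x = 0"
    show "\<phi> f y = 0"
    proof (rule ccontr)
      assume nz: "\<phi> f y \<noteq> 0"
      \<comment> \<open>Normalised to the value 1, just outside the open unit ball, although
        \<open>g\<close> still vanishes on \<open>K\<close>.\<close>
      define g where "g = (\<lambda>x\<in>topspace X. (1 / \<phi> f y) * f x)"
      have g: "g \<in> topspace DX" "\<phi> g y = 1"
        using scale_mem[OF f, of "1 / \<phi> f y"] map_scale[OF f y, of "1 / \<phi> f y"] nz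
        by (simp_all only: g_def) simp
      moreover have "g \<in> W"
        using van K(2) by (intro KW extensionalD[OF g(1)]) (auto simp: g_def)
      ultimately have "g \<in> {f \<in> topspace DX. \<phi> f y \<in> ball 0 1}"
        using pre by blast
      with g show False by simp
    qed
  qed
qed

text \<open>Bumps \<open>e k\<close> dual to the points of \<open>K\<close> interpolate
  \<open>f\<close> on \<open>K\<close>. The interpolant has the same image at \<open>y\<close> as
  \<open>f\<close>, so the coefficients are the values \<open>\<phi> (e k) y\<close>.\<close>

lemma finite_combination:
  assumes y: "y \<in> topspace Y"
  obtains S c where "finite S" "S \<subseteq> topspace X" "\<And>s. s \<in> S \<Longrightarrow> c s \<noteq> 0"
    "\<And>f. f \<in> topspace DX \<Longrightarrow> \<phi> f y = (\<Sum>s\<in>S. c s * f s)"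
proof -
  obtain K where K: "finite K" "K \<subseteq> topspace X"
    and det: "\<And>f. f \<in> topspace DX \<Longrightarrow> (\<And>x. x \<in> K \<Longrightarrow> f x = 0) \<Longrightarrow> \<phi> f y = 0"
    using finite_determining_set[OF y] by blast
  have "\<exists>e. e \<in> topspace DX \<and> e k = 1 \<and> (\<forall>z \<in> K - {k}. e z = 0)" if "k \<in> K" for k
  proof -
    have "closedin X (K - {k})" and "k \<in> topspace X" and "k \<notin> K - {k}"
      using K that by (auto intro: finite_closedin)
    then obtain e where "e \<in> topspace DX" "e k = 1" "\<forall>z\<in>K - {k}. e z = 0"
      by (rule bump)
    then show ?thesis by blast
  qed
  then obtain e where
    "\<forall>k\<in>K. e k \<in> topspace DX \<and> e k k = 1 \<and> (\<forall>z \<in> K - {k}. e k z = 0)"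
    using bchoice[of K "\<lambda>k e. e \<in> topspace DX \<and> e k = 1 \<and> (\<forall>z \<in> K - {k}. e z = 0)"] by blast
  then have e: "\<And>k. k \<in> K \<Longrightarrow> e k \<in> topspace DX"
    and e1: "\<And>k. k \<in> K \<Longrightarrow> e k k = 1"
    and e0: "\<And>k z. k \<in> K \<Longrightarrow> z \<in> K \<Longrightarrow> z \<noteq> k \<Longrightarrow> e k z = 0"
    by auto
  define c where "c k = \<phi> (e k) y" for k
  \<comment> \<open>Dropping zero coefficients keeps the sum and leaves exactly the points that
    matter for \<open>K_set\<close> and \<open>supp\<close>.\<close>
  define S where "S = {k \<in> K. c k \<noteq> 0}"
  have rep: "\<phi> f y = (\<Sum>s\<in>S. c s * f s)" if f: "f \<in> topspace DX" for f
  proof -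
    let ?s = "\<lambda>x\<in>topspace X. \<Sum>k\<in>K. f k * e k x"
    have s: "?s \<in> topspace DX" "\<phi> ?s y = (\<Sum>k\<in>K. f k * \<phi> (e k) y)"
      using sum_mem_map_sum[OF K(1) e y, where a = f] by auto
    have "\<phi> (\<lambda>x\<in>topspace X. f x - ?s x) y = 0"
    proof (rule det)
      fix x assume x: "x \<in> K"
      have "(\<Sum>k\<in>K. f k * e k x) = (\<Sum>k\<in>K. if k = x then f k else 0)"
        using e1 e0 x by (intro sum.cong) auto
      also have "\<dots> = f x"
        using K(1) x by simp
      finally show "(\<lambda>x\<in>topspace X. f x - ?s x) x = 0"
        using x K(2) by auto
    qed (rule diff_mem_map_diff(1)[OF f s(1)])
    then have "\<phi> f y = (\<Sum>k\<in>K. c k * f k)"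
      using diff_mem_map_diff(2)[OF f s(1) y] s(2) by (simp add: c_def mult.commute)
    also have "\<dots> = (\<Sum>s\<in>S. c s * f s)"
      using K(1) by (intro sum.mono_neutral_right) (auto simp: S_def)
    finally show ?thesis .
  qed
  show ?thesis
    using K rep by (intro that[of S c]) (auto simp: S_def)
qed

section \<open>Estimates for \<open>a_val\<close>\<close>

lemma a_val_le:
  assumes y: "y \<in> topspace Y" and K: "K \<subseteq> topspace X"
    and le: "\<And>f. f \<in> topspace DX \<Longrightarrow> (\<And>x. x \<in> K \<Longrightarrow> \<bar>f x\<bar> < 1) \<Longrightarrow> ennreal \<bar>\<phi> f y\<bar> \<le> B"
  shows "a_val DX \<phi> y K \<le> B"
  unfolding a_val_def
proof (rule SUP_least, clarsimp)
  fix f g assume f: "f \<in> topspace DX" and g: "g \<in> topspace DX"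
    and small: "\<forall>x\<in>K. \<bar>f x - g x\<bar> < 1"
  \<comment> \<open>By linearity, a pair matters only through its difference.\<close>
  have "ennreal \<bar>\<phi> (\<lambda>x\<in>topspace X. f x - g x) y\<bar> \<le> B"
    using small K by (intro le diff_mem_map_diff f g) (auto simp: subset_iff)
  then show "ennreal \<bar>\<phi> f y - \<phi> g y\<bar> \<le> B"
    by (simp add: diff_mem_map_diff(2)[OF f g y])
qed

lemma le_a_val:
  assumes y: "y \<in> topspace Y" and K: "K \<subseteq> topspace X"
    and f: "f \<in> topspace DX" "\<And>x. x \<in> K \<Longrightarrow> \<bar>f x\<bar> < 1"
  shows "ennreal \<bar>\<phi> f y\<bar> \<le> a_val DX \<phi> y K"
proof -
  let ?z = "\<lambda>x\<in>topspace X. 0"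
  have "ennreal \<bar>\<phi> f y - \<phi> ?z y\<bar> \<le> a_val DX \<phi> y K"
    unfolding a_val_def using f K zero_mem
    by (intro SUP_upper2[of "(f, ?z)"]) (auto simp: subset_iff)
  then show ?thesis
    by (simp add: map_zero[OF y])
qed

text \<open>All multiples of a function vanishing on \<open>K\<close> are smaller than 1 on
  \<open>K\<close>, so a nonzero value at \<open>y\<close> could be scaled past any finite
  \<open>a_val\<close>.\<close>

lemma map_eq_zero_if_a_val_finite:
  assumes y: "y \<in> topspace Y" and K: "K \<subseteq> topspace X" and fin: "a_val DX \<phi> y K < \<infinity>"
    and f: "f \<in> topspace DX" "\<And>x. x \<in> K \<Longrightarrow> f x = 0"
  shows "\<phi> f y = 0"
proof (rule ccontr)
  assume nz: "\<phi> f y \<noteq> 0"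
  obtain n :: nat where n: "a_val DX \<phi> y K < of_nat n"
    using fin ennreal_Ex_less_of_nat by auto
  let ?g = "\<lambda>x\<in>topspace X. (n / \<phi> f y) * f x"
  have "ennreal \<bar>\<phi> ?g y\<bar> \<le> a_val DX \<phi> y K"
    using f(2) K by (intro le_a_val y scale_mem f(1)) auto
  moreover have "\<phi> ?g y = n"
    using map_scale[OF f(1) y, of "n / \<phi> f y"] nz by simp
  ultimately show False
    using n by (simp add: ennreal_of_nat_eq_real_of_nat)
qed

section \<open>Identification of \<open>S\<close> with \<open>K_set\<close> and
  \<open>supp\<close>\<close>

context
  fixes y S c
  assumes y: "y \<in> topspace Y" and S: "finite S" "S \<subseteq> topspace X"
    and nonzero: "\<And>s. s \<in> S \<Longrightarrow> c s \<noteq> 0"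
    and rep: "\<And>f. f \<in> topspace DX \<Longrightarrow> \<phi> f y = (\<Sum>s\<in>S. c s * f s)"
begin

lemma combination_support_in_A_family: "S \<in> A_family X DX \<phi> y"
proof -
  have "a_val DX \<phi> y S \<le> ennreal (\<Sum>s\<in>S. \<bar>c s\<bar>)"
  proof (rule a_val_le[OF y S(2)])
    fix f assume f: "f \<in> topspace DX" and small: "\<And>x. x \<in> S \<Longrightarrow> \<bar>f x\<bar> < 1"
    have "\<bar>\<phi> f y\<bar> \<le> (\<Sum>s\<in>S. \<bar>c s * f s\<bar>)"
      unfolding rep[OF f] by (rule sum_abs)
    also have "\<dots> \<le> (\<Sum>s\<in>S. \<bar>c s\<bar>)"
      using small by (intro sum_mono) (auto simp: abs_mult intro!: mult_left_le intro: less_imp_le)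
    finally show "ennreal \<bar>\<phi> f y\<bar> \<le> ennreal (\<Sum>s\<in>S. \<bar>c s\<bar>)"
      by (rule ennreal_leI)
  qed
  then have "a_val DX \<phi> y S < \<infinity>"
    using ennreal_less_top order_le_less_trans by fastforce
  with S show ?thesis
    by (simp add: A_family_def)
qed

text \<open>A bump at \<open>s\<close> that also vanishes on the rest of \<open>S\<close> isolates
  the single term \<open>c s\<close>, which is nonzero.\<close>

lemma bump_at_combination_support:
  assumes "closedin X C" and "s \<in> S" and "s \<notin> C"
  obtains f where "f \<in> topspace DX" "\<And>z. z \<in> C \<Longrightarrow> f z = 0" "\<phi> f y \<noteq> 0"
proof -
  have "closedin X (C \<union> (S - {s}))"
    using S by (intro closedin_Un assms(1) finite_closedin) auto
  moreover have "s \<in> topspace X" and "s \<notin> C \<union> (S - {s})"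
    using assms(2,3) S(2) by auto
  ultimately obtain f where f: "f \<in> topspace DX" "f s = 1"
    and f0: "\<forall>z \<in> C \<union> (S - {s}). f z = 0"
    by (rule bump)
  have "\<phi> f y = c s * f s + (\<Sum>t\<in>S - {s}. c t * f t)"
    using rep[OF f(1)] sum.remove[OF S(1) assms(2)] by simp
  also have "\<dots> = c s"
    using f(2) f0 by simp
  finally show ?thesis
    using that[OF f(1)] f0 nonzero[OF assms(2)] by simp
qed

text \<open>\<open>S\<close> itself belongs to the family. A member \<open>K\<close> missing some
  \<open>s\<close> in \<open>S\<close> would force the value 0 on a bump at \<open>s\<close> that
  vanishes on \<open>K\<close>.\<close>

lemma K_set_eq_combination_support: "K_set X DX \<phi> y = S"
proof
  show "K_set X DX \<phi> y \<subseteq> S"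
    using combination_support_in_A_family by (auto simp: K_set_def)
  have "s \<in> K" if s: "s \<in> S" and K: "K \<in> A_family X DX \<phi> y" for s K
  proof (rule ccontr)
    assume "s \<notin> K"
    have K': "K \<subseteq> topspace X" "finite K" "a_val DX \<phi> y K < \<infinity>"
      using K by (auto simp: A_family_def)
    obtain f where "f \<in> topspace DX" "\<And>z. z \<in> K \<Longrightarrow> f z = 0" "\<phi> f y \<noteq> 0"
      using bump_at_combination_support[OF finite_closedin[OF K'(2,1)] s \<open>s \<notin> K\<close>] by blast
    with map_eq_zero_if_a_val_finite[OF y K'(1,3)] show False by blast
  qed
  with S(2) show "S \<subseteq> K_set X DX \<phi> y"
    by (auto simp: K_set_def)
qed

lemma supp_eq_combination_support: "supp X DX \<phi> y = S"
proof
  show "supp X DX \<phi> y \<subseteq> S"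
  proof
    fix x assume x: "x \<in> supp X DX \<phi> y"
    show "x \<in> S"
    proof (rule ccontr)
      assume "x \<notin> S"
      \<comment> \<open>The complement of \<open>S\<close> is a neighbourhood of \<open>x\<close>,
        and a function supported in it vanishes on \<open>S\<close>, hence has value 0 at
        \<open>y\<close>.\<close>
      have "openin X (topspace X - S)"
        using finite_closedin[OF S] by blast
      with x \<open>x \<notin> S\<close> have "x \<in> X interior_of (topspace X - S)"
        by (simp add: interior_of_openin supp_def)
      with x obtain f where f: "f \<in> topspace DX" "\<phi> f y \<noteq> 0"
        and van: "f ` (topspace X - (topspace X - S)) \<subseteq> {0}"
        unfolding supp_def by blast
      have "f s = 0" if "s \<in> S" for s
        using van that S(2) by (auto simp: subset_iff)
      with f rep[OF f(1)] show False by simp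
    qed
  qed
  show "S \<subseteq> supp X DX \<phi> y"
  proof
    fix x assume x: "x \<in> S"
    have "\<exists>f\<in>topspace DX. f ` (topspace X - U) \<subseteq> {0} \<and> \<phi> f y \<noteq> 0"
      if U: "x \<in> X interior_of U" for U
    proof -
      \<comment> \<open>The neighbourhood \<open>U\<close> need not be open; the bump is made to
        vanish off its interior, hence off \<open>U\<close>.\<close>
      have "closedin X (topspace X - X interior_of U)"
        by (simp add: closedin_diff)
      then obtain f where f: "f \<in> topspace DX" "\<phi> f y \<noteq> 0"
        and f0: "\<And>z. z \<in> topspace X - X interior_of U \<Longrightarrow> f z = 0"
        using bump_at_combination_support[of "topspace X - X interior_of U" x] x U by blast
      have "f ` (topspace X - U) \<subseteq> {0}"
        using f0 interior_of_subset[of X U] by blast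
      with f show ?thesis by blast
    qed
    with x S(2) show "x \<in> supp X DX \<phi> y"
      by (auto simp: supp_def)
  qed
qed

lemma a_val_combination_support_le: "a_val DX \<phi> y S \<le> map_norm X Y DX \<phi>"
proof (rule a_val_le[OF y S(2)])
  fix f assume f: "f \<in> topspace DX" and small: "\<And>x. x \<in> S \<Longrightarrow> \<bar>f x\<bar> < 1"
  obtain g where g: "g \<in> topspace DX" "\<And>x. x \<in> S \<Longrightarrow> g x = f x" "sup_norm X g < 1"
    using truncation[OF f S small] by blast
  \<comment> \<open>The combination reads only values on \<open>S\<close>, where truncation changes
    nothing.\<close>
  have "\<phi> f y = \<phi> g y"
    using rep f g by simp
  then show "ennreal \<bar>\<phi> f y\<bar> \<le> map_norm X Y DX \<phi>"
    unfolding map_norm_def using g y by (intro SUP_upper2[of "(g, y)"]) auto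
qed

end

section \<open>The two conclusions\<close>

lemma K_set_eq_supp:
  assumes y: "y \<in> topspace Y"
  shows "K_set X DX \<phi> y = supp X DX \<phi> y"
proof -
  obtain S c where S: "finite S" "S \<subseteq> topspace X" "\<And>s. s \<in> S \<Longrightarrow> c s \<noteq> 0"
    "\<And>f. f \<in> topspace DX \<Longrightarrow> \<phi> f y = (\<Sum>s\<in>S. c s * f s)"
    using finite_combination[OF y] by blast
  show ?thesis
    using K_set_eq_combination_support[OF y S] supp_eq_combination_support[OF y S] by simp
qed

text \<open>Sup norm below 1 makes \<open>f\<close> smaller than 1 on every \<open>K\<close>, so
  each \<open>a_val\<close> bounds the values at its point \<open>y\<close>.\<close>

lemma map_norm_le:
  assumes "\<And>y. y \<in> topspace Y \<Longrightarrow> \<exists>K\<subseteq>topspace X. a_val DX \<phi> y K \<le> B"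
  shows "map_norm X Y DX \<phi> \<le> B"
  unfolding map_norm_def
proof (rule SUP_least, clarsimp)
  fix f y assume f: "f \<in> topspace DX" "sup_norm X f < 1" and y: "y \<in> topspace Y"
  obtain K where K: "K \<subseteq> topspace X" "a_val DX \<phi> y K \<le> B"
    using assms[OF y] by blast
  have "\<bar>f x\<bar> < 1" if "x \<in> topspace X" for x
  proof -
    have "ennreal \<bar>f x\<bar> \<le> sup_norm X f"
      unfolding sup_norm_def using that by (rule SUP_upper)
    with f(2) have "ennreal \<bar>f x\<bar> < 1"
      by (rule le_less_trans[rotated])
    then show ?thesis by (simp add: ennreal_less_one_iff)
  qed
  then have "ennreal \<bar>\<phi> f y\<bar> \<le> a_val DX \<phi> y K"
    using K(1) by (intro le_a_val y f(1)) auto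
  with K(2) show "ennreal \<bar>\<phi> f y\<bar> \<le> B" by simp
qed

lemma bounded_iff_norm_bounded: "bounded_map X Y DX \<phi> \<longleftrightarrow> norm_bounded_map X Y DX \<phi>"
proof
  assume "bounded_map X Y DX \<phi>"
  then obtain m :: nat where
    "\<And>y. y \<in> topspace Y \<Longrightarrow> \<exists>K\<subseteq>topspace X. a_val DX \<phi> y K \<le> of_nat m"
    unfolding bounded_map_def by blast
  then have "map_norm X Y DX \<phi> \<le> of_nat m"
    by (rule map_norm_le)
  then show "norm_bounded_map X Y DX \<phi>"
    unfolding norm_bounded_map_def using of_nat_less_top order_le_less_trans by fastforce
next
  assume "norm_bounded_map X Y DX \<phi>"
  \<comment> \<open>A natural number above the norm serves as the common bound for all
    \<open>y\<close>, with the finite set \<open>S\<close> depending on \<open>y\<close>.\<close>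
  then obtain m :: nat where m: "map_norm X Y DX \<phi> < of_nat m"
    unfolding norm_bounded_map_def using ennreal_Ex_less_of_nat by auto
  have "\<exists>K. K \<subseteq> topspace X \<and> finite K \<and> a_val DX \<phi> y K \<le> of_nat m"
    if y: "y \<in> topspace Y" for y
  proof -
    obtain S c where S: "finite S" "S \<subseteq> topspace X"
      "\<And>s. s \<in> S \<Longrightarrow> c s \<noteq> 0"
      "\<And>f. f \<in> topspace DX \<Longrightarrow> \<phi> f y = (\<Sum>s\<in>S. c s * f s)"
      using finite_combination[OF y] by blast
    have "a_val DX \<phi> y S \<le> of_nat m"
      using a_val_combination_support_le[OF y S] m by (rule order.trans[OF _ less_imp_le])
    with S(1,2) show ?thesis by blast
  qed
  then show "bounded_map X Y DX \<phi>"
    unfolding bounded_map_def by blast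
qed

end

theorem proposition2p3:
  fixes X :: "'a topology" and Y :: "'b topology"
    and DX :: "('a \<Rightarrow> real) topology" and DY :: "('b \<Rightarrow> real) topology"
    and \<phi> :: "('a \<Rightarrow> real) \<Rightarrow> ('b \<Rightarrow> real)"
  assumes "Tychonoff_space X" and "Tychonoff_space Y"
    and "DX = C_p X \<or> DX = C_p_star X"
    and "DY = C_p Y \<or> DY = C_p_star Y"
    and "continuous_map DX DY \<phi>"
    and "linear_fun_map X Y DX \<phi>"
    and "DY closure_of (\<phi> ` topspace DX) = topspace DY"
  shows "(\<forall>y \<in> topspace Y. K_set X DX \<phi> y = supp X DX \<phi> y) \<and>
         (bounded_map X Y DX \<phi> \<longleftrightarrow> norm_bounded_map X Y DX \<phi>)"
proof -
  \<comment> \<open>Either choice of \<open>DY\<close> is a subspace of the power topology, so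
    continuity passes to each coordinate \<open>\<phi> f y\<close>.\<close>
  have "continuous_map DX (powertop_real (topspace Y)) \<phi>"
    using assms(4,5) by (auto simp: C_p_def C_p_star_def continuous_map_in_subtopology)
  then have "continuous_map DX euclideanreal (\<lambda>f. \<phi> f y)" if "y \<in> topspace Y" for y
    using that by (simp add: continuous_map_componentwise)
  then interpret D_linear_map X DX Y \<phi>
    using assms(1,3,6) by unfold_locales auto
  show ?thesis
    using K_set_eq_supp bounded_iff_norm_bounded by blast
qed

end
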